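(* For every integer $n\ge2$, \[ CP_{(3,0)}(n)=\frac{1+q^{2n-3}+q^{2n-2}}{(1-q^{2n-1})(1-q^{2n})}CP_{(3,0)}(n-1)-\frac{q^{4n-7}}{(1-q^{2n-3})(1-q^{2n-2})(1-q^{2n-1})(1-q^{2n})}CP_{(3,0)}(n-2). \]
   Context: A cylindric partition with profile $(c_1,c_2)$ is a pair of partitions $(\lambda^{(1)},\lambda^{(2)})$ (parts in weakly decreasing order, $\lambda^{(i)}_j=0$ beyond the number of parts) with $\lambda^{(1)}_j\ge\lambda^{(2)}_{j+c_2}$ and $\lambda^{(2)}_j\ge\lambda^{(1)}_{j+c_1}$ for all $j\ge1$; its size is $|\lambda^{(1)}|+|\lambda^{(2)}|$. $CP_{(3,0)}(n)$ is the generating function $\sum q^{\text{size}}$ over cylindric partitions of profile $(3,0)$ in which each partition has at most $n$ parts, with $CP_{(3,0)}(0)=1$. *)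

theory Defs
  imports "HOL-Computational_Algebra.Formal_Power_Series"
begin

definition is_partition :: "nat list \<Rightarrow> bool" where
  "is_partition l \<longleftrightarrow> sorted_wrt (\<ge>) l \<and> 0 \<notin> set l"

text \<open>Parts are indexed from 1 and are 0 beyond the number of parts.\<close>

definition part :: "nat list \<Rightarrow> nat \<Rightarrow> nat" where
  "part l j = (if 1 \<le> j \<and> j \<le> length l then l ! (j - 1) else 0)"

definition cylindric_partition :: "nat \<times> nat \<Rightarrow> nat list \<times> nat list \<Rightarrow> bool" where
  "cylindric_partition = (\<lambda>(c1, c2) (l1, l2).
     is_partition l1 \<and> is_partition l2 \<and>
     (\<forall>j\<ge>1. part l1 j \<ge> part l2 (j + c2)) \<and>
     (\<forall>j\<ge>1. part l2 j \<ge> part l1 (j + c1)))"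

definition cp_size :: "nat list \<times> nat list \<Rightarrow> nat" where
  "cp_size = (\<lambda>(l1, l2). sum_list l1 + sum_list l2)"

definition bounded_cps :: "nat \<times> nat \<Rightarrow> nat \<Rightarrow> (nat list \<times> nat list) set" where
  "bounded_cps c n = {(l1, l2). cylindric_partition c (l1, l2) \<and> length l1 \<le> n \<and> length l2 \<le> n}"

text \<open>
  The generating function lives in \<^typ>\<open>rat fps\<close>, with \<^const>\<open>fps_X\<close> in the role of $q$, so that
  series with nonzero constant term can be inverted.
\<close>

definition CP :: "nat \<times> nat \<Rightarrow> nat \<Rightarrow> rat fps" where
  "CP c n = Abs_fps (\<lambda>m. of_nat (card {p \<in> bounded_cps c n. cp_size p = m}))"

lemma finite_bounded_cps_size: "finite {p \<in> bounded_cps c n. cp_size p = m}"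
proof (rule finite_subset)
  let ?L = "{xs. set xs \<subseteq> {..m} \<and> length xs \<le> n}"
  have le: "set xs \<subseteq> {..m}" if "sum_list xs \<le> m" for xs
    using member_le_sum_list[of _ xs] that order_trans by blast
  show "{p \<in> bounded_cps c n. cp_size p = m} \<subseteq> ?L \<times> ?L"
  proof
    fix p assume p: "p \<in> {p \<in> bounded_cps c n. cp_size p = m}"
    obtain l1 l2 where [simp]: "p = (l1, l2)" by (cases p)
    from p have "length l1 \<le> n" "length l2 \<le> n" "sum_list l1 \<le> m" "sum_list l2 \<le> m"
      by (simp_all add: bounded_cps_def cp_size_def)
    with le show "p \<in> ?L \<times> ?L" by simp
  qed
  show "finite (?L \<times> ?L)"
    using finite_lists_length_le[of "{..m}" n] by simp
qed

lemma CP_0: "CP c 0 = 1"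
proof -
  have "cylindric_partition c ([], [])"
    by (simp add: cylindric_partition_def is_partition_def part_def split: prod.split)
  hence "bounded_cps c 0 = {([], [])}"
    unfolding bounded_cps_def by auto
  hence "{p \<in> bounded_cps c 0. cp_size p = m} = (if m = 0 then {([], [])} else {})" for m
    by (cases m) (simp_all add: cp_size_def Collect_conv_if)
  thus ?thesis
    by (simp add: CP_def fps_eq_iff)
qed

end

theory Submission
  imports Defs
begin

text \<open>
  Let $F(x,y)$ count the cylindric partitions of profile $(3,0)$ whose two partitions have at most
  $x$ and $y$ parts. If $y \le x \le y + 3$, subtracting 1 from every part shows that those with
  exactly $x$ and $y$ parts contribute $q^{x+y} F(x,y)$, so by inclusion-exclusion
  $(1 - q^{x+y}) F(x,y) = F(x-1,y) + F(x,y-1) - F(x-1,y-1)$. The profile forces the difference of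
  the two numbers of parts to lie between 0 and 3, whence $F(x-1,x) = F(x-1,x-1)$ and
  $F(y+3,y-1) = F(y+2,y-1)$. The resulting closed linear system for $F(n,n)$, $F(n,n-1)$,
  $F(n,n-2)$ and $F(n,n-3)$ is then eliminated down to $CP_{(3,0)}(n) = F(n,n)$.
\<close>

section \<open>Partitions as sequences of parts\<close>

lemma part_pos_iff:
  assumes "is_partition l"
  shows "0 < part l j \<longleftrightarrow> 1 \<le> j \<and> j \<le> length l"
proof (cases "1 \<le> j \<and> j \<le> length l")
  case True
  hence "l ! (j - 1) \<in> set l"
    by (intro nth_mem) linarith
  with assms True show ?thesis
    by (auto simp: part_def is_partition_def intro!: Nat.gr0I)
qed (auto simp: part_def)

lemma part_antimono:
  assumes "is_partition l" "1 \<le> i" "i \<le> j"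
  shows "part l j \<le> part l i"
proof (cases "i = j")
  case False
  then show ?thesis
    using assms by (auto simp: part_def is_partition_def sorted_wrt_iff_nth_less)
qed simp

text \<open>Since zeros are excluded, the indices of positive parts determine the length, and then
  the parts determine the entries.\<close>

lemma partition_eqI:
  assumes "is_partition l" "is_partition l'" "\<And>j. 1 \<le> j \<Longrightarrow> part l j = part l' j"
  shows "l = l'"
proof -
  have "1 \<le> j \<and> j \<le> length l \<longleftrightarrow> 1 \<le> j \<and> j \<le> length l'" for j
    using part_pos_iff[OF assms(1), of j] part_pos_iff[OF assms(2), of j] assms(3)[of j] by auto
  from this[of "length l"] this[of "length l'"] have len: "length l = length l'"
    by linarith
  show ?thesis
  proof (rule nth_equalityI[OF len])
    fix i assume "i < length l"
    with assms(3)[of "Suc i"] len show "l ! i = l' ! i"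
      by (simp add: part_def)
  qed
qed

text \<open>Needed to undo \<open>raise\<close>, where parts equal to 1 disappear. Induction on
  \<open>x\<close> strips trailing zeros; once the last value is nonzero, monotonicity makes all
  earlier ones nonzero.\<close>

lemma ex_partition_with_parts:
  assumes "\<And>i j. 1 \<le> i \<Longrightarrow> i \<le> j \<Longrightarrow> f j \<le> f i" "\<And>j. j > x \<Longrightarrow> f j = 0"
  shows "\<exists>l. is_partition l \<and> length l \<le> x \<and> (\<forall>j\<ge>1. part l j = f j)"
  using assms(2)
proof (induction x)
  case 0
  then show ?case
    by (intro exI[of _ "[]"]) (auto simp: is_partition_def part_def)
next
  case (Suc x)
  show ?case
  proof (cases "f (Suc x) = 0")
    case True
    with Suc.prems have "f j = 0" if "j > x" for j
      using that by (cases "j = Suc x") auto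
    from Suc.IH[OF this] show ?thesis
      by (meson le_SucI)
  next
    case False
    let ?l = "map f [1..<Suc (Suc x)]"
    have nz: "f i \<noteq> 0" if "1 \<le> i" "i \<le> Suc x" for i
      using assms(1)[OF that] False by linarith
    have "0 \<notin> set ?l"
    proof
      assume "0 \<in> set ?l"
      then obtain i where "1 \<le> i" "i \<le> Suc x" "f i = 0"
        by (auto simp del: upt_Suc)
      with nz show False
        by blast
    qed
    hence "is_partition ?l"
      using assms(1) by (auto simp: is_partition_def sorted_wrt_iff_nth_less simp del: upt_Suc)
    moreover have "part ?l j = f j" if "1 \<le> j" for j
      using that Suc.prems[of j] by (auto simp: part_def simp del: upt_Suc)
    ultimately show ?thesis
      by (intro exI[of _ ?l]) auto
  qed
qed

section \<open>Adding 1 to every part\<close>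

text \<open>Padding with zeros up to \<open>x\<close> entries restores the parts that vanish when 1
  is subtracted from a partition with exactly \<open>x\<close> parts.\<close>

definition raise :: "nat \<Rightarrow> nat list \<Rightarrow> nat list" where
  "raise x l = map Suc (l @ replicate (x - length l) 0)"

lemma length_raise: "length l \<le> x \<Longrightarrow> length (raise x l) = x"
  by (simp add: raise_def)

lemma part_raise:
  "length l \<le> x \<Longrightarrow> part (raise x l) j = (if 1 \<le> j \<and> j \<le> x then Suc (part l j) else 0)"
  by (auto simp: part_def raise_def nth_append)

lemma sum_list_map_Suc: "sum_list (map Suc l) = length l + sum_list l"
  by (induction l) auto

lemma sum_list_raise: "length l \<le> x \<Longrightarrow> sum_list (raise x l) = x + sum_list l"
  unfolding raise_def sum_list_map_Suc by (simp add: sum_list_replicate)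

lemma is_partition_raise: "is_partition l \<Longrightarrow> is_partition (raise x l)"
  by (auto simp: is_partition_def raise_def sorted_wrt_iff_nth_less nth_append)

lemma raise_inj:
  assumes "is_partition l" "is_partition l'" "length l \<le> x" "length l' \<le> x" "raise x l = raise x l'"
  shows "l = l'"
proof (rule partition_eqI[OF assms(1,2)])
  fix j :: nat assume "1 \<le> j"
  have "part (raise x l) j = part (raise x l') j"
    using assms(5) by simp
  with assms(3,4) \<open>1 \<le> j\<close> show "part l j = part l' j"
    \<comment> \<open>For \<open>j > x\<close> the raised lists say nothing, but the length bounds
      make both parts 0.\<close>
    by (cases "j \<le> x") (simp_all add: part_raise, simp add: part_def)
qed

lemma raise_surj:
  assumes "is_partition m" "length m = x"
  obtains l where "is_partition l" "length l \<le> x" "raise x l = m" "\<And>j. 1 \<le> j \<Longrightarrow> part l j = part m j - 1"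
proof -
  have "\<exists>l. is_partition l \<and> length l \<le> x \<and> (\<forall>j\<ge>1. part l j = part m j - 1)"
  proof (rule ex_partition_with_parts)
    show "part m j - 1 \<le> part m i - 1" if "1 \<le> i" "i \<le> j" for i j
      using part_antimono[OF assms(1) that] by simp
    show "part m j - 1 = 0" if "j > x" for j
      using that assms(2) by (simp add: part_def)
  qed
  then obtain l where l: "is_partition l" "length l \<le> x" "\<And>j. 1 \<le> j \<Longrightarrow> part l j = part m j - 1"
    by blast
  have "raise x l = m"
  proof (rule partition_eqI[OF is_partition_raise[OF l(1)] assms(1)])
    fix j :: nat assume "1 \<le> j"
    then show "part (raise x l) j = part m j"
      using part_pos_iff[OF assms(1), of j] assms(2) by (auto simp: part_raise[OF l(2)] l(3))
  qed
  with l that show thesis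
    by blast
qed

section \<open>Cylindric partitions and their numbers of parts\<close>

text \<open>Each cylindric inequality is read at the first index where its larger side is 0.\<close>

lemma cylindric_partition_lengths:
  assumes "cylindric_partition (c1, c2) (l1, l2)"
  shows "length l2 \<le> length l1 + c2" "length l1 \<le> length l2 + c1"
proof -
  have *: "is_partition l1" "is_partition l2" "part l2 (Suc (length l1) + c2) \<le> part l1 (Suc (length l1))"
      "part l1 (Suc (length l2) + c1) \<le> part l2 (Suc (length l2))"
    using assms by (auto simp: cylindric_partition_def)
  show "length l2 \<le> length l1 + c2"
    using *(3) part_pos_iff[OF *(2), of "Suc (length l1) + c2"] part_pos_iff[OF *(1), of "Suc (length l1)"]
    by linarith
  show "length l1 \<le> length l2 + c1"
    using *(4) part_pos_iff[OF *(1), of "Suc (length l2) + c1"] part_pos_iff[OF *(2), of "Suc (length l2)"]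
    by linarith
qed

text \<open>If \<open>j + c2 \<le> y\<close> then \<open>j \<le> x\<close>, so whenever the smaller
  side of an inequality gains 1, so does the larger; likewise for \<open>c1\<close>.\<close>

lemma cylindric_partition_raise:
  assumes "cylindric_partition (c1, c2) (l1, l2)" "length l1 \<le> x" "length l2 \<le> y"
    and "y \<le> x + c2" "x \<le> y + c1"
  shows "cylindric_partition (c1, c2) (raise x l1, raise y l2)"
  using assms by (auto simp: cylindric_partition_def is_partition_raise part_raise)

text \<open>
  The bounds on the numbers of parts are strict, so that the set is empty when a bound is 0; the
  recurrences below then hold without boundary cases.
\<close>

definition cp_box :: "nat \<times> nat \<Rightarrow> nat \<Rightarrow> nat \<Rightarrow> nat \<Rightarrow> (nat list \<times> nat list) set" where
  "cp_box c x y m = {(l1, l2). cylindric_partition c (l1, l2) \<and> length l1 < x \<and> length l2 < y \<and>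
     sum_list l1 + sum_list l2 = m}"

definition cp_gf :: "nat \<times> nat \<Rightarrow> nat \<Rightarrow> nat \<Rightarrow> rat fps" where
  "cp_gf c x y = Abs_fps (\<lambda>m. of_nat (card (cp_box c x y m)))"

definition cp_exact :: "nat \<times> nat \<Rightarrow> nat \<Rightarrow> nat \<Rightarrow> nat \<Rightarrow> (nat list \<times> nat list) set" where
  "cp_exact c x y m = {(l1, l2). cylindric_partition c (l1, l2) \<and> length l1 = x \<and> length l2 = y \<and>
     sum_list l1 + sum_list l2 = m}"

lemma finite_cp_box: "finite (cp_box c x y m)"
  by (rule finite_subset[OF _ finite_bounded_cps_size[of c "x + y" m]])
     (auto simp: cp_box_def bounded_cps_def cp_size_def)

lemma CP_eq_cp_gf: "CP c n = cp_gf c (Suc n) (Suc n)"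
proof -
  have "{p \<in> bounded_cps c n. cp_size p = m} = cp_box c (Suc n) (Suc n) m" for m
    by (auto simp: bounded_cps_def cp_size_def cp_box_def)
  then show ?thesis
    by (simp add: CP_def cp_gf_def)
qed

text \<open>The bounds in \<open>cp_box\<close> being strict, \<open>Suc x\<close> and
  \<open>Suc y\<close> admit up to \<open>x\<close> and \<open>y\<close> parts, just what
  \<open>raise\<close> can pad.\<close>

lemma bij_betw_raise:
  assumes "y \<le> x + c2" "x \<le> y + c1"
  shows "bij_betw (\<lambda>(l1, l2). (raise x l1, raise y l2))
    (cp_box (c1, c2) (Suc x) (Suc y) m) (cp_exact (c1, c2) x y (m + x + y))"
proof (rule bij_betw_imageI)
  show "inj_on (\<lambda>(l1, l2). (raise x l1, raise y l2)) (cp_box (c1, c2) (Suc x) (Suc y) m)"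
    by (auto simp: inj_on_def cp_box_def cylindric_partition_def less_Suc_eq_le intro: raise_inj)
  show "(\<lambda>(l1, l2). (raise x l1, raise y l2)) ` cp_box (c1, c2) (Suc x) (Suc y) m =
    cp_exact (c1, c2) x y (m + x + y)" (is "?f ` ?A = ?B")
  proof
    show "?f ` ?A \<subseteq> ?B"
      using cylindric_partition_raise[OF _ _ _ assms]
      by (auto simp: cp_box_def cp_exact_def length_raise sum_list_raise)
    show "?B \<subseteq> ?f ` ?A"
    proof
      fix p assume "p \<in> ?B"
      then obtain m1 m2 where p: "p = (m1, m2)" "cylindric_partition (c1, c2) (m1, m2)"
          "length m1 = x" "length m2 = y" "sum_list m1 + sum_list m2 = m + x + y"
        by (auto simp: cp_exact_def)
      from p(2) have parts: "is_partition m1" "is_partition m2"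
        and ineqs: "\<And>j. j \<ge> 1 \<Longrightarrow> part m2 (j + c2) \<le> part m1 j" "\<And>j. j \<ge> 1 \<Longrightarrow> part m1 (j + c1) \<le> part m2 j"
        by (auto simp: cylindric_partition_def)
      from raise_surj[OF parts(1) p(3)] obtain l1 where l1: "is_partition l1" "length l1 \<le> x"
          "raise x l1 = m1" "\<And>j. 1 \<le> j \<Longrightarrow> part l1 j = part m1 j - 1"
        by blast
      from raise_surj[OF parts(2) p(4)] obtain l2 where l2: "is_partition l2" "length l2 \<le> y"
          "raise y l2 = m2" "\<And>j. 1 \<le> j \<Longrightarrow> part l2 j = part m2 j - 1"
        by blast
      have "cylindric_partition (c1, c2) (l1, l2)"
        \<comment> \<open>Truncated subtraction is monotone, so the inequalities survive lowering
          both sides by 1.\<close>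
        using l1(1) l2(1) ineqs by (auto simp: cylindric_partition_def l1(4) l2(4) intro!: diff_le_mono)
      moreover have "sum_list l1 + sum_list l2 = m"
        using p(5) sum_list_raise[OF l1(2)] sum_list_raise[OF l2(2)] l1(3) l2(3) by simp
      ultimately have "(l1, l2) \<in> ?A"
        using l1(2) l2(2) by (simp add: cp_box_def)
      then show "p \<in> ?f ` ?A"
        using p(1) l1(3) l2(3) by force
    qed
  qed
qed

lemma card_cp_exact:
  assumes "y \<le> x + c2" "x \<le> y + c1"
  shows "card (cp_exact (c1, c2) x y m) =
    (if m < x + y then 0 else card (cp_box (c1, c2) (Suc x) (Suc y) (m - (x + y))))"
proof (cases "m < x + y")
  case True
  \<comment> \<open>Positive parts make the size at least the number of parts.\<close>
  have "length l \<le> sum_list l" if "is_partition l" for l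
    using that by (induction l) (auto simp: is_partition_def)
  from this add_mono[OF this this] have "cp_exact (c1, c2) x y m = {}"
    using True by (fastforce simp: cp_exact_def cylindric_partition_def)
  with True show ?thesis
    by simp
next
  case False
  with bij_betw_same_card[OF bij_betw_raise[OF assms, of "m - (x + y)"]] show ?thesis
    by simp
qed

section \<open>Inclusion-exclusion and the resulting recurrences\<close>

text \<open>A pair in the largest box either obeys a smaller bound or attains both maximal lengths.
  The additive form avoids subtraction of naturals.\<close>

lemma card_cp_box_Suc_Suc:
  "card (cp_box c (Suc x) (Suc y) m) + card (cp_box c x y m) =
    card (cp_box c x (Suc y) m) + card (cp_box c (Suc x) y m) + card (cp_exact c x y m)"
proof -
  let ?U = "cp_box c x (Suc y) m \<union> cp_box c (Suc x) y m"
  have "finite (cp_exact c x y m)"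
    by (rule finite_subset[OF _ finite_cp_box[of c "Suc x" "Suc y" m]]) (auto simp: cp_exact_def cp_box_def)
  moreover have "?U \<inter> cp_exact c x y m = {}"
    by (auto simp: cp_exact_def cp_box_def)
  moreover have "cp_box c (Suc x) (Suc y) m = ?U \<union> cp_exact c x y m"
    by (auto simp: cp_exact_def cp_box_def)
  ultimately have "card (cp_box c (Suc x) (Suc y) m) = card ?U + card (cp_exact c x y m)"
    by (simp add: card_Un_disjoint finite_cp_box)
  moreover have "cp_box c x (Suc y) m \<inter> cp_box c (Suc x) y m = cp_box c x y m"
    by (auto simp: cp_box_def)
  ultimately show ?thesis
    using card_Un_Int[OF finite_cp_box finite_cp_box, of c x "Suc y" m c "Suc x" y m] by simp
qed

lemma cp_gf_Suc_Suc:
  assumes "y \<le> x + c2" "x \<le> y + c1"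
  shows "cp_gf (c1, c2) (Suc x) (Suc y) * (1 - fps_X ^ (x + y)) =
    cp_gf (c1, c2) x (Suc y) + cp_gf (c1, c2) (Suc x) y - cp_gf (c1, c2) x y"
proof -
  have "cp_gf (c1, c2) (Suc x) (Suc y) + cp_gf (c1, c2) x y =
    cp_gf (c1, c2) x (Suc y) + cp_gf (c1, c2) (Suc x) y + fps_X ^ (x + y) * cp_gf (c1, c2) (Suc x) (Suc y)"
  proof (rule fps_ext)
    fix m
    show "fps_nth (cp_gf (c1, c2) (Suc x) (Suc y) + cp_gf (c1, c2) x y) m =
      fps_nth (cp_gf (c1, c2) x (Suc y) + cp_gf (c1, c2) (Suc x) y +
        fps_X ^ (x + y) * cp_gf (c1, c2) (Suc x) (Suc y)) m"
      using arg_cong[OF card_cp_box_Suc_Suc[of "(c1, c2)" x y m], of "of_nat :: nat \<Rightarrow> rat"]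
      by (simp add: cp_gf_def fps_X_power_mult_nth card_cp_exact[OF assms])
  qed
  then show ?thesis
    by (simp add: algebra_simps)
qed

lemma cp_gf_cong:
  assumes "\<And>l1 l2. cylindric_partition c (l1, l2) \<Longrightarrow>
    length l1 < x \<and> length l2 < y \<longleftrightarrow> length l1 < x' \<and> length l2 < y'"
  shows "cp_gf c x y = cp_gf c x' y'"
proof -
  have "cp_box c x y m = cp_box c x' y' m" for m
    using assms by (auto simp: cp_box_def)
  then show ?thesis
    by (simp add: cp_gf_def)
qed

text \<open>With \<open>c2 = 0\<close> the second partition has no more parts than the first, so two
  terms of \<open>cp_gf_Suc_Suc\<close> cancel.\<close>

lemma cp_gf_diagonal:
  "cp_gf (c1, 0) (Suc x) (Suc x) * (1 - fps_X ^ (2 * x)) = cp_gf (c1, 0) (Suc x) x"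
proof -
  have "cp_gf (c1, 0) x (Suc x) = cp_gf (c1, 0) x x"
    by (rule cp_gf_cong) (auto dest: cylindric_partition_lengths)
  with cp_gf_Suc_Suc[of x x 0 c1] show ?thesis
    by (simp add: mult_2)
qed

text \<open>The first partition exceeds the second by at most \<open>Suc c\<close> parts, so again
  two terms cancel. This closes the system at the maximal difference.\<close>

lemma cp_gf_extreme:
  "cp_gf (Suc c, c2) (y + Suc c) y * (1 - fps_X ^ (2 * y + c - 1)) = cp_gf (Suc c, c2) (y + c) y"
proof (cases y)
  case 0
  \<comment> \<open>The strict bound 0 leaves the box empty, so both sides vanish whatever the
    truncated exponent is.\<close>
  have "cp_gf (Suc c, c2) x 0 = 0" for x
    by (simp add: cp_gf_def cp_box_def fps_eq_iff)
  with 0 show ?thesis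
    by simp
next
  case (Suc z)
  have "cp_gf (Suc c, c2) (Suc (z + Suc c)) z = cp_gf (Suc c, c2) (z + Suc c) z"
    by (rule cp_gf_cong) (auto dest: cylindric_partition_lengths)
  with cp_gf_Suc_Suc[of z "z + Suc c" c2 "Suc c"] show ?thesis
    by (simp add: Suc mult_2 add_ac)
qed

section \<open>Elimination in the linear system\<close>

text \<open>Taking \<open>n = m + 2\<close> and clearing denominators keeps division and natural
  subtraction out of the elimination.\<close>

lemma CP_recurrence:
  fixes q :: "rat fps"
  defines "q \<equiv> fps_X"
  shows "CP (3, 0) (m + 2) *
      ((1 - q ^ (2*m + 1)) * (1 - q ^ (2*m + 2)) * (1 - q ^ (2*m + 3)) * (1 - q ^ (2*m + 4))) =
    (1 + q ^ (2*m + 1) + q ^ (2*m + 2)) * ((1 - q ^ (2*m + 1)) * (1 - q ^ (2*m + 2))) * CP (3, 0) (m + 1)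
    - q ^ (4*m + 1) * CP (3, 0) m"
proof -
  define H where "H = cp_gf (3, 0)"
  define t where "t = q ^ (2 * m)"
  have diag: "H (Suc x) (Suc x) * (1 - q ^ (2 * x)) = H (Suc x) x" for x
    unfolding H_def q_def by (rule cp_gf_diagonal)
  have rec: "H (Suc x) (Suc y) * (1 - q ^ (x + y)) = H x (Suc y) + H (Suc x) y - H x y"
    if "y \<le> x" "x \<le> y + 3" for x y
    unfolding H_def q_def using cp_gf_Suc_Suc[of y x 0 3] that by simp
  have pow: "q ^ (2*m + 1) = t * q" "q ^ (2*m + 2) = t * q^2" "q ^ (2*m + 3) = t * q^3"
      "q ^ (2*m + 4) = t * q^4" "q ^ (4*m + 1) = t^2 * q"
    by (simp_all add: t_def power_add[symmetric] power_mult[symmetric] flip: power_Suc2)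
  have e1: "H (m+3) (m+3) * (1 - t * q^4) = H (m+3) (m+2)"
    using diag[of "m+2"] by (simp add: t_def eval_nat_numeral mult_ac)
  have e2: "H (m+3) (m+2) * (1 - t * q^3) = H (m+2) (m+2) + H (m+3) (m+1) - H (m+2) (m+1)"
    using rec[of "m+1" "m+2"] by (simp add: t_def eval_nat_numeral mult_ac)
  have e3: "H (m+2) (m+2) * (1 - t * q^2) = H (m+2) (m+1)"
    using diag[of "m+1"] by (simp add: t_def eval_nat_numeral mult_ac)
  have e4: "H (m+3) (m+1) * (1 - t * q^2) = H (m+2) (m+1) + H (m+3) m - H (m+2) m"
    using rec[of m "m+2"] by (simp add: t_def eval_nat_numeral mult_ac)
  have e5: "H (m+3) m * (1 - t * q) = H (m+2) m"
    using cp_gf_extreme[of 2 0 m] by (simp add: H_def q_def t_def eval_nat_numeral mult_ac)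
  have e6: "H (m+2) (m+1) * (1 - t * q) = H (m+1) (m+1) + H (m+2) m - H (m+1) m"
    using rec[of m "m+1"] by (simp add: t_def eval_nat_numeral mult_ac)
  have e7: "H (m+1) (m+1) * (1 - t) = H (m+1) m"
    using diag[of m] by (simp add: t_def)
  define A0 A1 A2 where "A0 = H (m+1) (m+1)" and "A1 = H (m+2) (m+2)" and "A2 = H (m+3) (m+3)"
  define C1 C2 D2 where "C1 = H (m+2) m" and "C2 = H (m+3) (m+1)" and "D2 = H (m+3) m"
  note defs = A0_def A1_def A2_def C1_def C2_def D2_def
  \<comment> \<open>The diagonal relations \<open>e1\<close>, \<open>e3\<close> and
    \<open>e7\<close> remove the series whose two bounds differ by 1.\<close>
  have C2: "C2 = A2 * ((1 - t * q^3) * (1 - t * q^4)) - t * q^2 * A1"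
    using e2 unfolding e1[symmetric] e3[symmetric] defs[symmetric] by (simp add: algebra_simps)
  have C1: "C1 = A1 * ((1 - t * q) * (1 - t * q^2)) - t * A0"
    using e6 unfolding e3[symmetric] e7[symmetric] defs[symmetric] by (simp add: algebra_simps)
  have D2: "C1 = D2 * (1 - t * q)"
    using e5 unfolding defs by simp
  have "C2 * (1 - t * q^2) = A1 * (1 - t * q^2) + D2 - C1"
    using e4 unfolding e3[symmetric] defs by simp
  \<comment> \<open>The extra factor \<open>1 - t * q\<close> turns \<open>D2\<close> into
    \<open>C1\<close>, leaving only \<open>C1\<close> and \<open>C2\<close> to substitute.\<close>
  hence "C2 * (1 - t * q^2) * (1 - t * q) = (A1 * (1 - t * q^2) + D2 - C1) * (1 - t * q)"
    by simp
  also have "\<dots> = A1 * ((1 - t * q) * (1 - t * q^2)) + t * q * C1"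
    unfolding D2 by (simp add: algebra_simps)
  finally have "A2 * ((1 - t * q) * (1 - t * q^2) * (1 - t * q^3) * (1 - t * q^4)) =
    (1 + t * q + t * q^2) * ((1 - t * q) * (1 - t * q^2)) * A1 - t^2 * q * A0"
    unfolding C2 C1 by (simp add: algebra_simps power2_eq_square)
  moreover have "CP (3, 0) m = A0" "CP (3, 0) (m + 1) = A1" "CP (3, 0) (m + 2) = A2"
    by (simp_all add: CP_eq_cp_gf A0_def A1_def A2_def H_def eval_nat_numeral)
  ultimately show ?thesis
    by (simp only: pow)
qed

theorem theorem4p4:
  fixes n :: nat and q :: "rat fps"
  defines "q \<equiv> fps_X"
  assumes "n \<ge> 2"
  shows "CP (3, 0) n =
    (1 + q ^ (2*n - 3) + q ^ (2*n - 2)) / ((1 - q ^ (2*n - 1)) * (1 - q ^ (2*n))) * CP (3, 0) (n - 1)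
    - q ^ (4*n - 7) / ((1 - q ^ (2*n - 3)) * (1 - q ^ (2*n - 2)) * (1 - q ^ (2*n - 1)) * (1 - q ^ (2*n)))
      * CP (3, 0) (n - 2)"
proof -
  obtain m where n: "n = m + 2"
    using assms(2) le_Suc_ex by (metis add.commute)
  have idx: "2*n - 3 = 2*m + 1" "2*n - 2 = 2*m + 2" "2*n - 1 = 2*m + 3" "2*n = 2*m + 4"
      "4*n - 7 = 4*m + 1" "n - 1 = m + 1" "n - 2 = m"
    using n by auto
  define d where "d k = 1 - q ^ k" for k
  \<comment> \<open>Constant term 1 makes every denominator a unit, so division of series is
    genuine.\<close>
  have d0: "fps_nth (d k) 0 = 1" if "k > 0" for k
    using that by (simp add: d_def q_def)
  have div: "a / b * b = a" if "fps_nth b 0 \<noteq> 0" for a b :: "rat fps"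
    using that by (simp add: fps_divide_unit mult.assoc inverse_mult_eq_1)
  define D where "D = d (2*m+1) * d (2*m+2) * d (2*m+3) * d (2*m+4)"
  define N where "N = 1 + q ^ (2*m + 1) + q ^ (2*m + 2)"
  have D0: "fps_nth D 0 \<noteq> 0"
    by (simp add: D_def d0)
  have "(N / (d (2*m+3) * d (2*m+4)) * CP (3, 0) (m+1) - q ^ (4*m + 1) / D * CP (3, 0) m) * D =
    (N / (d (2*m+3) * d (2*m+4)) * (d (2*m+3) * d (2*m+4))) * (d (2*m+1) * d (2*m+2)) * CP (3, 0) (m+1)
    - (q ^ (4*m + 1) / D * D) * CP (3, 0) m"
    by (simp add: D_def algebra_simps)
  also have "\<dots> = N * (d (2*m+1) * d (2*m+2)) * CP (3, 0) (m+1) - q ^ (4*m + 1) * CP (3, 0) m"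
    using D0 by (simp add: div d0)
  also have "\<dots> = CP (3, 0) (m + 2) * D"
    using CP_recurrence[of m] by (simp add: D_def N_def d_def q_def)
  finally have "CP (3, 0) (m + 2) =
      N / (d (2*m+3) * d (2*m+4)) * CP (3, 0) (m+1) - q ^ (4*m + 1) / D * CP (3, 0) m"
    using D0 by auto
  then show ?thesis
    \<comment> \<open>The order matters: rewriting \<open>2*n\<close> or \<open>n\<close> earlier
      would destroy the left-hand sides of the other index equations.\<close>
    unfolding idx(1-3,5-7) unfolding idx(4) unfolding n D_def N_def d_def .
qed

end
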